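(* Let $n$ be a positive integer and let $k,a$ be complex numbers with $a\neq 0$, $k\neq-1$, such that all the functions below are defined. Then $$\sum _{p=1}^n \left(-2^{1+p}\right)^k \left(\zeta \left(-k,\frac{1}{6} \left(1-\frac{3\cdot 2^{-p} \log (a)}{\pi }\right)\right)+\zeta \left(-k,\frac{1}{6} \left(5-\frac{3\cdot 2^{-p} \log (a)}{\pi }\right)\right)\right)$$ $$=(-2)^k \left(\zeta \left(-k,\frac{1}{3}-\frac{\log (a)}{2 \pi }\right)+\zeta \left(-k,\frac{2}{3}-\frac{\log (a)}{2 \pi }\right)\right)$$ $$-\left(-2^{1+n}\right)^k \left(\zeta \left(-k,\frac{1}{6} \left(2-\frac{3\cdot 2^{-n} \log (a)}{\pi }\right)\right)+\zeta \left(-k,\frac{1}{6} \left(4-\frac{3\cdot 2^{-n} \log (a)}{\pi }\right)\right)\right).$$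
   Context: $\zeta(s,v)$ is the Hurwitz zeta function, $\zeta(s,v)=\sum_{j=0}^\infty (j+v)^{-s}$ for $\operatorname{Re}s>1$, $v\notin\{0,-1,-2,\dots\}$, continued analytically in $s$ to $\mathbb{C}\setminus\{1\}$. Logarithms and powers are principal values. *)

theory Defs
  imports "HOL-Complex_Analysis.Complex_Analysis"
begin

text \<open>
  The Hurwitz zeta function \<open>\<zeta>(s, v)\<close> for complex \<open>v\<close> outside \<open>{0, -1, -2, \<dots>}\<close> and \<open>s \<noteq> 1\<close>:
  the analytic continuation in \<open>s\<close> to the punctured plane of the Dirichlet-type series on
  \<open>Re s > 1\<close>. The punctured plane is connected, so the conditions on \<open>f\<close> determine
  every value except the one at \<open>s = 1\<close>, which is arbitrary. For nonpositive integers \<open>v\<close>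
  the value is meaningless.
\<close>

definition hurwitz_zeta :: "complex \<Rightarrow> complex \<Rightarrow> complex" where
  "hurwitz_zeta s v =
     (SOME f. f holomorphic_on (- {1}) \<and>
        (\<forall>z. Re z > 1 \<longrightarrow> (\<lambda>j::nat. (of_nat j + v) powr (- z)) sums f z)) s"

end

theory Submission
  imports Defs
begin

text \<open>
  Write \<open>s = -k\<close>, \<open>u p = Ln a / (2 \<pi> 2 ^ p)\<close> and \<open>F p = \<zeta>(s, 1/3 - u p) + \<zeta>(s, 2/3 - u p)\<close>. Halving
  \<open>1/3 - u p\<close> and \<open>2/3 - u p\<close> with the duplication formula
  \<open>\<zeta>(s, v/2) + \<zeta>(s, (v+1)/2) = 2 powr s * \<zeta>(s, v)\<close> produces the four arguments \<open>1/6 - u (p+1)\<close>,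
  \<open>2/3 - u (p+1)\<close>, \<open>1/3 - u (p+1)\<close>, \<open>5/6 - u (p+1)\<close>. The outer two are those of the
  summand with index \<open>p + 1\<close> and the inner two those of \<open>F (p+1)\<close>, so this summand's bracket is
  \<open>2 powr s * F p - F (p+1)\<close>. A positive real factor splits off a principal power, also when
  the rest of the base is negative; hence, weighted by \<open>(-(2 ^ (p+2))) powr k\<close>, this is a
  difference of consecutive values of \<open>(-(2 ^ (p+1))) powr k * F p\<close>, and the sum telescopes
  (\<open>hurwitz_zeta_telescoping_sum\<close>).

  The duplication formula (\<open>hurwitz_zeta_duplication\<close>) is a regrouping of the series for \<open>Re s > 1\<close>
  and extends to \<open>s \<noteq> 1\<close> by the identity theorem. This uses that the continuation which
  the definition of \<open>hurwitz_zeta\<close> chooses does exist (\<open>hurwitz_continuation_exists\<close>).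

  For that, let \<open>D s = (\<Sum>j. (j + v) powr (-s))\<close> with \<open>Re v \<ge> 1\<close>. Summing the Taylor expansion
  of \<open>(w + 1) powr (1 - s)\<close> around \<open>w\<close> over \<open>w = j + v\<close> telescopes on one side and expresses
  \<open>(s - 1) * D s\<close> through \<open>D (s + 1)\<close>, \<dots>, \<open>D (s + M - 1)\<close> and a series of remainders that converges for
  \<open>Re s > 1 - M\<close> (\<open>hurwitz_series_recurrence\<close>). So \<open>(s - 1) * D s\<close> extends from each half-plane to one
  that reaches further left by one, and finally to an entire function. Splitting off finitely
  many terms of the series removes the condition on \<open>Re v\<close>.
\<close>

section \<open>Holomorphy of series with a power majorant\<close>

text \<open>
  The exponent of the majorant may vary with \<open>s\<close>, since on a small disc around a point it stays
  uniformly below \<open>-1\<close>; this gives a Weierstrass majorant there.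
\<close>

lemma holomorphic_suminf_powr_majorant:
  fixes f :: "nat \<Rightarrow> complex \<Rightarrow> complex" and C :: "complex \<Rightarrow> real" and M :: real
  assumes hol: "\<And>j. f j holomorphic_on {s. Re s > 1 - M}"
    and cont: "continuous_on UNIV C"
    and bound: "\<And>j s. Re s > 1 - M \<Longrightarrow> norm (f j s) \<le> C s * real (Suc j) powr (- (Re s + M))"
  shows "(\<lambda>s. \<Sum>j. f j s) holomorphic_on {s. Re s > 1 - M}"
    and "Re s > 1 - M \<Longrightarrow> summable (\<lambda>j. f j s)"
proof -
  have C_nonneg: "C s \<ge> 0" if "Re s > 1 - M" for s
    using order_trans[OF norm_ge_zero bound[OF that, of 0]] by simp
  have summ: "summable (\<lambda>j. B * real (Suc j) powr (- (1 + d)))" if "d > 0" for B d :: real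
  proof (intro summable_mult)
    have "summable (\<lambda>j. real j powr (- (1 + d)))"
      using that by (simp only: summable_real_powr_iff)
    then show "summable (\<lambda>j. real (Suc j) powr (- (1 + d)))"
      by (rule summable_ignore_initial_segment[where k = 1, simplified])
  qed
  have open_U: "open {s. Re s > 1 - M}"
    by (rule open_halfspace_Re_gt)
  show "(\<lambda>s. \<Sum>j. f j s) holomorphic_on {s. Re s > 1 - M}"
  proof (rule holomorphic_uniform_sequence[OF open_U])
    show "(\<lambda>s. \<Sum>j<n. f j s) holomorphic_on {s. Re s > 1 - M}" for n
      by (intro holomorphic_on_sum hol)
  next
    fix x assume "x \<in> {s. Re s > 1 - M}"
    \<comment> \<open>Half the distance to the boundary line, so that the decay stays summable on the whole disc.\<close>
    define d where "d = (Re x + M - 1) / 2"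
    have "d > 0" using \<open>x \<in> _\<close> by (simp add: d_def)
    have Re_ge: "Re s + M \<ge> 1 + d" if "s \<in> cball x d" for s
    proof -
      have "Re x - Re s \<le> d"
        using that complex_Re_le_cmod[of "x - s"] by (simp add: dist_norm)
      then show ?thesis by (simp add: d_def field_simps)
    qed
    have sub: "cball x d \<subseteq> {s. Re s > 1 - M}"
      using Re_ge \<open>d > 0\<close> by force
    have "bounded (C ` cball x d)"
      using compact_continuous_image[OF continuous_on_subset[OF cont]] by (intro compact_imp_bounded) auto
    then obtain B where B: "\<And>s. s \<in> cball x d \<Longrightarrow> C s \<le> B"
      unfolding bounded_iff by (metis abs_le_D1 imageI real_norm_def)
    have "norm (f j s) \<le> B * real (Suc j) powr (- (1 + d))" if "s \<in> cball x d" for j s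
    proof -
      have s: "Re s > 1 - M" using sub that by auto
      have "norm (f j s) \<le> C s * real (Suc j) powr (- (Re s + M))"
        by (rule bound[OF s])
      also have "\<dots> \<le> B * real (Suc j) powr (- (1 + d))"
        using Re_ge[OF that] B[OF that] C_nonneg[OF s] by (intro mult_mono powr_mono) auto
      finally show ?thesis .
    qed
    then have "uniform_limit (cball x d) (\<lambda>n s. \<Sum>j<n. f j s) (\<lambda>s. \<Sum>j. f j s) sequentially"
      by (rule Weierstrass_m_test[OF _ summ[OF \<open>d > 0\<close>]])
    with \<open>d > 0\<close> sub
    show "\<exists>d. 0 < d \<and> cball x d \<subseteq> {s. Re s > 1 - M} \<and>
        uniform_limit (cball x d) (\<lambda>n s. \<Sum>j<n. f j s) (\<lambda>s. \<Sum>j. f j s) sequentially"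
      by blast
  qed
  show "summable (\<lambda>j. f j s)" if s: "Re s > 1 - M"
  proof (rule summable_comparison_test')
    show "summable (\<lambda>j. C s * real (Suc j) powr (- (1 + (Re s + M - 1))))"
      using s by (intro summ) simp
    show "norm (f j s) \<le> C s * real (Suc j) powr (- (1 + (Re s + M - 1)))" if "j \<ge> 0" for j
      using bound[OF s, of j] by (simp only: add_diff_cancel_left' add_diff_eq)
  qed
qed

text \<open>
  The modulus of \<open>w powr b\<close> is \<open>norm w powr Re b\<close> times a factor coming from the argument of
  \<open>w\<close>, which is at most \<open>\<pi>\<close> in modulus. So the estimate is uniform in \<open>w\<close>.
\<close>

lemma norm_powr_neg_le:
  fixes w b :: complex
  assumes "Re w \<ge> r" "r > 0" "Re b \<le> 0"
  shows "norm (w powr b) \<le> exp (pi * \<bar>Im b\<bar>) * r powr Re b"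
proof -
  have "r \<le> norm w" using assms complex_Re_le_cmod[of w] by linarith
  then have "norm w powr Re b \<le> r powr Re b"
    using assms powr_mono2'[of "Re b" r "norm w"] by auto
  moreover have "- Im b * Arg w \<le> pi * \<bar>Im b\<bar>"
  proof -
    have "\<bar>Arg w\<bar> \<le> pi" using Arg_bounded[of w] by auto
    then have "\<bar>Im b * Arg w\<bar> \<le> \<bar>Im b\<bar> * pi" unfolding abs_mult by (intro mult_left_mono) auto
    then show ?thesis by (simp add: mult.commute abs_le_iff)
  qed
  ultimately show ?thesis
    unfolding norm_powr_complex by (subst mult.commute) (intro mult_mono, auto)
qed

section \<open>Taylor remainders of complex powers\<close>

definition powr_Taylor_remainder :: "nat \<Rightarrow> complex \<Rightarrow> complex \<Rightarrow> complex" where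
  "powr_Taylor_remainder M w s =
     (w + 1) powr (1 - s) - (\<Sum>m\<le>M. ((1 - s) gchoose m) * w powr (1 - s - of_nat m))"

text \<open>
  Taylor's theorem on the half-plane \<open>Re t \<ge> r\<close>, which contains both \<open>w\<close> and \<open>w + 1\<close>. The power in
  the next derivative has exponent \<open>- s - M\<close>, which makes the remainder decay faster as
  \<open>M\<close> grows.
\<close>

lemma norm_powr_Taylor_remainder_le:
  assumes w: "Re w \<ge> r" "r > 0" and s: "Re s + real M \<ge> 0"
  shows "norm (powr_Taylor_remainder M w s) \<le>
    real (Suc M) * norm ((1 - s) gchoose Suc M) * exp (pi * \<bar>Im s\<bar>) * r powr (- (Re s + real M))"
proof -
  \<comment> \<open>The derivative of order \<open>i\<close> of \<open>t powr (1 - s)\<close>.\<close>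
  define f where "f i t = fact i * ((1 - s) gchoose i) * t powr (1 - s - of_nat i)" for i t
  define S where "S = {t. Re t \<ge> r}"
  define B where "B = fact (Suc M) * norm ((1 - s) gchoose Suc M) *
                        (exp (pi * \<bar>Im s\<bar>) * r powr (- (Re s + real M)))"
  have "convex S" unfolding S_def by (rule convex_halfspace_Re_ge)
  have der: "(f i has_field_derivative f (Suc i) t) (at t within S)" if "t \<in> S" for i t
  proof -
    have t: "t \<notin> \<real>\<^sub>\<le>\<^sub>0" using that w by (auto simp: S_def complex_nonpos_Reals_iff)
    have deriv: "(f i has_field_derivative
        fact i * ((1 - s) gchoose i) * ((1 - s - of_nat i) * t powr (1 - s - of_nat i - 1))) (at t)"
      unfolding f_def by (intro DERIV_cmult has_field_derivative_powr t)
    have "of_nat (Suc i) * ((1 - s) gchoose Suc i) = (1 - s - of_nat i) * ((1 - s) gchoose i)"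
      using gbinomial_mult_1[of "1 - s" i] by (simp add: algebra_simps)
    moreover have "f (Suc i) t = fact i * (of_nat (Suc i) * ((1 - s) gchoose Suc i)) * t powr (1 - s - of_nat (Suc i))"
      unfolding f_def by (simp only: fact_Suc of_nat_mult mult_ac)
    ultimately have "fact i * ((1 - s) gchoose i) * ((1 - s - of_nat i) * t powr (1 - s - of_nat i - 1)) = f (Suc i) t"
      by (simp only: of_nat_Suc diff_diff_eq add.assoc add.commute[of 1] mult_ac)
    with deriv show ?thesis by (simp add: has_field_derivative_at_within)
  qed
  have bound: "norm (f (Suc M) t) \<le> B" if "t \<in> S" for t
  proof -
    have "norm (t powr (1 - s - of_nat (Suc M))) \<le> exp (pi * \<bar>Im s\<bar>) * r powr (- (Re s + real M))"
      using norm_powr_neg_le[of r t "1 - s - of_nat (Suc M)"] that w s by (simp add: S_def algebra_simps)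
    then show ?thesis
      unfolding f_def B_def norm_mult by (intro mult_mono) (auto simp: norm_mult simp del: fact_Suc)
  qed
  have "norm (f 0 (w + 1) - (\<Sum>i\<le>M. f i w * (w + 1 - w) ^ i / fact i)) \<le>
          B * norm (w + 1 - w) ^ Suc M / fact M"
    using w by (intro complex_Taylor[OF \<open>convex S\<close> der bound]) (auto simp: S_def)
  moreover have "f 0 (w + 1) - (\<Sum>i\<le>M. f i w * (w + 1 - w) ^ i / fact i) = powr_Taylor_remainder M w s"
    by (simp add: f_def powr_Taylor_remainder_def)
  moreover have "B * norm (w + 1 - w) ^ Suc M / fact M =
      real (Suc M) * norm ((1 - s) gchoose Suc M) * exp (pi * \<bar>Im s\<bar>) * r powr (- (Re s + real M))"
    by (simp add: B_def)
  ultimately show ?thesis by simp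
qed

lemma holomorphic_on_gbinomial [holomorphic_intros]:
  "f holomorphic_on A \<Longrightarrow> (\<lambda>s. f s gchoose m) holomorphic_on A"
  unfolding gbinomial_prod_rev
  by (intro holomorphic_on_divide holomorphic_on_prod holomorphic_on_diff holomorphic_on_const) auto

lemma continuous_on_gbinomial [continuous_intros]:
  fixes f :: "complex \<Rightarrow> complex"
  shows "continuous_on A f \<Longrightarrow> continuous_on A (\<lambda>s. f s gchoose m)"
  unfolding gbinomial_prod_rev
  by (intro continuous_on_divide continuous_on_prod continuous_on_diff continuous_on_const) auto

lemma holomorphic_suminf_powr_Taylor_remainder:
  assumes v: "Re v \<ge> 1"
  shows "(\<lambda>s. \<Sum>j. powr_Taylor_remainder M (of_nat j + v) s) holomorphic_on {s. Re s > 1 - real M}"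
    and "Re s > 1 - real M \<Longrightarrow> summable (\<lambda>j. powr_Taylor_remainder M (of_nat j + v) s)"
proof -
  define C where "C = (\<lambda>s. real (Suc M) * norm ((1 - s) gchoose Suc M) * exp (pi * \<bar>Im s\<bar>))"
  have 1: "powr_Taylor_remainder M (of_nat j + v) holomorphic_on {s. Re s > 1 - real M}" for j
    unfolding powr_Taylor_remainder_def by (intro holomorphic_intros)
  have 2: "continuous_on UNIV C"
    unfolding C_def by (intro continuous_intros)
  have 3: "norm (powr_Taylor_remainder M (of_nat j + v) s) \<le> C s * real (Suc j) powr (- (Re s + real M))"
    if "Re s > 1 - real M" for j s
    unfolding C_def using that v by (intro norm_powr_Taylor_remainder_le) auto
  show "(\<lambda>s. \<Sum>j. powr_Taylor_remainder M (of_nat j + v) s) holomorphic_on {s. Re s > 1 - real M}"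
    by (rule holomorphic_suminf_powr_majorant(1)[OF 1 2 3])
  show "Re s > 1 - real M \<Longrightarrow> summable (\<lambda>j. powr_Taylor_remainder M (of_nat j + v) s)"
    by (rule holomorphic_suminf_powr_majorant(2)[OF 1 2 3])
qed

section \<open>Analytic continuation of the Hurwitz series\<close>

lemma holomorphic_hurwitz_series:
  assumes v: "Re v \<ge> 1"
  shows "(\<lambda>s. \<Sum>j. (of_nat j + v) powr (- s)) holomorphic_on {s. Re s > 1}"
    and "Re s > 1 \<Longrightarrow> summable (\<lambda>j. (of_nat j + v) powr (- s))"
proof -
  define C where "C = (\<lambda>s::complex. exp (pi * \<bar>Im s\<bar>))"
  have 1: "(\<lambda>s. (of_nat j + v) powr (- s)) holomorphic_on {s. Re s > 1 - 0}" for j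
    by (intro holomorphic_intros)
  have 2: "continuous_on UNIV C"
    unfolding C_def by (intro continuous_intros)
  have 3: "norm ((of_nat j + v) powr (- s)) \<le> C s * real (Suc j) powr (- (Re s + 0))"
    if "Re s > 1 - 0" for j s
    using norm_powr_neg_le[of "real (Suc j)" "of_nat j + v" "- s"] that v by (simp add: C_def)
  show "(\<lambda>s. \<Sum>j. (of_nat j + v) powr (- s)) holomorphic_on {s. Re s > 1}"
    using holomorphic_suminf_powr_majorant(1)[OF 1 2 3] unfolding diff_zero .
  show "Re s > 1 \<Longrightarrow> summable (\<lambda>j. (of_nat j + v) powr (- s))"
    using holomorphic_suminf_powr_majorant(2)[OF 1 2 3] unfolding diff_zero .
qed

text \<open>
  Both sides come from summing \<open>(w + 1) powr (1 - s) - w powr (1 - s)\<close> over \<open>w = j + v\<close>. Directly this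
  telescopes to \<open>- (v powr (1 - s))\<close>; by Taylor expansion, the term of order \<open>m\<close> contributes a
  multiple of \<open>D (s + m - 1)\<close>, and the term of order 1 is the multiple \<open>1 - s\<close> of \<open>D s\<close>.
\<close>

lemma hurwitz_series_recurrence:
  assumes v: "Re v \<ge> 1" and s: "Re s > 1" and "M \<ge> 1"
  defines "D \<equiv> \<lambda>s. \<Sum>j. (of_nat j + v) powr (- s)"
  shows "(s - 1) * D s = v powr (1 - s) + (\<Sum>m=2..M. ((1 - s) gchoose m) * D (s + of_nat m - 1)) +
           (\<Sum>j. powr_Taylor_remainder M (of_nat j + v) s)"
proof -
  have lim: "(\<lambda>j. (of_nat j + v) powr (1 - s)) \<longlonglongrightarrow> 0"
  proof (rule Lim_null_comparison)
    have "norm ((of_nat j + v) powr (1 - s)) \<le> exp (pi * \<bar>Im s\<bar>) * real (Suc j) powr (1 - Re s)" for j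
      using norm_powr_neg_le[of "real (Suc j)" "of_nat j + v" "1 - s"] s v by simp
    then show "\<forall>\<^sub>F j in sequentially. norm ((of_nat j + v) powr (1 - s)) \<le>
        exp (pi * \<bar>Im s\<bar>) * real (Suc j) powr (1 - Re s)"
      by simp
    show "(\<lambda>j. exp (pi * \<bar>Im s\<bar>) * real (Suc j) powr (1 - Re s)) \<longlonglongrightarrow> 0"
    proof (rule tendsto_mult_right_zero)
      have "(\<lambda>j. real j powr (1 - Re s)) \<longlonglongrightarrow> 0"
        using s by (intro tendsto_neg_powr filterlim_real_sequentially) auto
      then show "(\<lambda>j. real (Suc j) powr (1 - Re s)) \<longlonglongrightarrow> 0"
        by (rule LIMSEQ_Suc)
    qed
  qed
  have tele: "(\<lambda>j. (of_nat j + v + 1) powr (1 - s) - (of_nat j + v) powr (1 - s)) sums (0 - v powr (1 - s))"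
    using telescope_sums[OF lim] by (simp add: algebra_simps)
  have D: "(\<lambda>j. (of_nat j + v) powr (1 - s - of_nat m)) sums D (s + of_nat m - 1)" if "m \<ge> 1" for m
  proof -
    have "Re (s + of_nat m - 1) > 1" using s that by simp
    from summable_sums[OF holomorphic_hurwitz_series(2)[OF v this]] show ?thesis
      by (simp add: D_def algebra_simps)
  qed
  have "(\<lambda>j. (\<Sum>m=1..M. ((1 - s) gchoose m) * (of_nat j + v) powr (1 - s - of_nat m)) +
              powr_Taylor_remainder M (of_nat j + v) s) sums
          ((\<Sum>m=1..M. ((1 - s) gchoose m) * D (s + of_nat m - 1)) +
           (\<Sum>j. powr_Taylor_remainder M (of_nat j + v) s))"
    using s by (intro sums_add sums_sum sums_mult D summable_sums
                 holomorphic_suminf_powr_Taylor_remainder(2)[OF v]) auto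
  moreover have "(\<Sum>m=1..M. ((1 - s) gchoose m) * w powr (1 - s - of_nat m)) + powr_Taylor_remainder M w s
      = (w + 1) powr (1 - s) - w powr (1 - s)" for w
    by (simp add: powr_Taylor_remainder_def sum.atMost_shift atMost_atLeast0 sum.atLeast_Suc_atMost)
  ultimately have "(\<Sum>m=1..M. ((1 - s) gchoose m) * D (s + of_nat m - 1)) +
           (\<Sum>j. powr_Taylor_remainder M (of_nat j + v) s) = - (v powr (1 - s))"
    using sums_unique2[OF _ tele] by simp
  moreover have "(\<Sum>m=1..M. ((1 - s) gchoose m) * D (s + of_nat m - 1)) =
      (1 - s) * D s + (\<Sum>m=2..M. ((1 - s) gchoose m) * D (s + of_nat m - 1))"
    using \<open>M \<ge> 1\<close> by (subst sum.atLeast_Suc_atMost) (auto simp: numeral_2_eq_2)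
  moreover have "A + R = - P \<Longrightarrow> A = (1 - s) * E + B \<Longrightarrow> (s - 1) * E = P + B + R" for A R P E B :: complex
    by algebra
  ultimately show ?thesis by blast
qed

text \<open>
  The factor \<open>s - 1\<close> removes the pole, so that the induction stays within functions
  holomorphic on half-planes. In the recurrence, \<open>D (s + m - 1)\<close> is the known function \<open>h\<close> divided by
  \<open>s + m - 2\<close>; its coefficient \<open>(1 - s) gchoose m\<close> contains this very factor, which is why the extended
  function can be written with \<open>((1 - s) gchoose (m - 1)) / m\<close> and without a division by \<open>s + m - 2\<close>.
\<close>

lemma hurwitz_continuation_halfplane:
  assumes v: "Re v \<ge> 1"
  shows "\<exists>h. h holomorphic_on {s. Re s > 1 - real N} \<and>
             (\<forall>s. Re s > 1 \<longrightarrow> h s = (s - 1) * (\<Sum>j. (of_nat j + v) powr (- s)))"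
proof (induction N)
  case 0
  show ?case
    by (rule exI[of _ "\<lambda>s. (s - 1) * (\<Sum>j. (of_nat j + v) powr (- s))"])
       (auto intro!: holomorphic_intros holomorphic_hurwitz_series v)
next
  case (Suc N)
  then obtain h where hol: "h holomorphic_on {s. Re s > 1 - real N}"
    and h: "\<And>s. Re s > 1 \<Longrightarrow> h s = (s - 1) * (\<Sum>j. (of_nat j + v) powr (- s))" by blast
  define U where "U = {s. Re s > 1 - real (Suc N)}"
  define h' where "h' = (\<lambda>s. v powr (1 - s)
      + (\<Sum>m=2..Suc N. - (((1 - s) gchoose (m - 1)) / of_nat m) * h (s + of_nat m - 1))
      + (\<Sum>j. powr_Taylor_remainder (Suc N) (of_nat j + v) s))"
  have shift: "(\<lambda>s. h (s + of_nat m - 1)) holomorphic_on U" if "m \<ge> 2" for m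
  proof -
    have "h \<circ> (\<lambda>s. s + of_nat m - 1) holomorphic_on U"
      by (rule holomorphic_on_compose_gen[OF _ hol]) (use that in \<open>auto intro!: holomorphic_intros simp: U_def\<close>)
    then show ?thesis by (simp add: o_def)
  qed
  have "h' holomorphic_on U"
    unfolding h'_def using holomorphic_suminf_powr_Taylor_remainder(1)[OF v, of "Suc N"]
    by (intro holomorphic_intros shift) (auto simp: U_def)
  moreover have "h' s = (s - 1) * (\<Sum>j. (of_nat j + v) powr (- s))" if s: "Re s > 1" for s
  proof -
    have "- (((1 - s) gchoose (m - 1)) / of_nat m) * h (s + of_nat m - 1) =
        ((1 - s) gchoose m) * (\<Sum>j. (of_nat j + v) powr (- (s + of_nat m - 1)))" if "m \<in> {2..Suc N}" for m
    proof -
      obtain k where m: "m = Suc k" using \<open>m \<in> _\<close> by (cases m) auto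
      have "of_nat m * ((1 - s) gchoose m) = - ((1 - s) gchoose k) * (s + of_nat m - 1 - 1)"
        using gbinomial_mult_1[of "1 - s" k] by (simp add: m algebra_simps)
      then have "((1 - s) gchoose m) = - (((1 - s) gchoose k) / of_nat m) * (s + of_nat m - 1 - 1)"
        by (simp add: m field_simps del: of_nat_Suc)
      moreover have "h (s + of_nat m - 1) =
          (s + of_nat m - 1 - 1) * (\<Sum>j. (of_nat j + v) powr (- (s + of_nat m - 1)))"
        using s \<open>m \<in> _\<close> by (intro h) auto
      ultimately show ?thesis by (simp add: m)
    qed
    then have "h' s = v powr (1 - s)
      + (\<Sum>m=2..Suc N. ((1 - s) gchoose m) * (\<Sum>j. (of_nat j + v) powr (- (s + of_nat m - 1))))
      + (\<Sum>j. powr_Taylor_remainder (Suc N) (of_nat j + v) s)"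
      unfolding h'_def by (simp only: cong: sum.cong)
    then show ?thesis
      using hurwitz_series_recurrence[OF v s, of "Suc N"] by simp
  qed
  ultimately show ?case unfolding U_def by blast
qed

text \<open>
  The extensions to the half-planes agree where they are both defined, by the identity theorem, and
  therefore glue.
\<close>

lemma hurwitz_continuation_entire:
  assumes v: "Re v \<ge> 1"
  obtains H where "H holomorphic_on UNIV"
    and "\<And>s. Re s > 1 \<Longrightarrow> H s = (s - 1) * (\<Sum>j. (of_nat j + v) powr (- s))"
proof -
  define U where "U N = {s. Re s > 1 - real N}" for N
  obtain h where hol: "\<And>N. h N holomorphic_on U N"
    and h: "\<And>N s. Re s > 1 \<Longrightarrow> h N s = (s - 1) * (\<Sum>j. (of_nat j + v) powr (- s))"
    using hurwitz_continuation_halfplane[OF v] unfolding U_def by metis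
  have opn: "open (U N)" for N unfolding U_def by (rule open_halfspace_Re_gt)
  have conn: "connected (U N)" for N
    unfolding U_def by (intro convex_connected convex_halfspace_Re_gt)
  have U_mono: "U N \<subseteq> U N'" if "N \<le> N'" for N N'
    using that by (auto simp: U_def)
  have agree_le: "h N s = h N' s" if "N \<le> N'" "s \<in> U N" for N N' s
  proof (rule analytic_continuation_open[of "U 0" "U N" "h N" "h N'"])
    show "U 0 \<noteq> {}" by (auto simp: U_def intro!: exI[of _ 2])
    show "h N z = h N' z" if "z \<in> U 0" for z using that h by (simp add: U_def)
    show "h N' holomorphic_on U N" by (rule holomorphic_on_subset[OF hol U_mono[OF that(1)]])
  qed (use that opn conn hol U_mono[of 0 N] in auto)
  have agree: "h N s = h N' s" if "s \<in> U N" "s \<in> U N'" for N N' s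
  proof (cases "N \<le> N'")
    case True
    then show ?thesis using that(1) by (rule agree_le)
  next
    case False
    then have "N' \<le> N" by simp
    then show ?thesis using that(2) by (rule agree_le[symmetric])
  qed
  \<comment> \<open>The index of some half-plane containing \<open>s\<close>.\<close>
  define idx where "idx s = nat \<lceil>2 - Re s\<rceil>" for s
  have idx: "s \<in> U (idx s)" for s
    unfolding U_def idx_def mem_Collect_eq by linarith
  define H where "H s = h (idx s) s" for s
  have H_eq: "H s = h N s" if "s \<in> U N" for s N
    unfolding H_def by (rule agree[OF idx that])
  have "H holomorphic_on U N" for N
    by (rule holomorphic_transform[OF hol H_eq[symmetric]])
  then have "H holomorphic_on (\<Union>N. U N)"
    by (intro holomorphic_on_UN_open opn)
  moreover have "(\<Union>N. U N) = UNIV" using idx by auto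
  ultimately have "H holomorphic_on UNIV" by simp
  moreover have "H s = (s - 1) * (\<Sum>j. (of_nat j + v) powr (- s))" if "Re s > 1" for s
    using H_eq[of s 0] h[of s 0] that by (simp add: U_def)
  ultimately show ?thesis by (rule that)
qed

text \<open>
  The first \<open>J\<close> terms of the series are entire in \<open>s\<close>, and the others form the series for \<open>J + v\<close>, whose real
  part is at least 1 when \<open>J\<close> is large.
\<close>

lemma hurwitz_continuation_exists:
  assumes v: "v \<notin> \<int>\<^sub>\<le>\<^sub>0"
  shows "\<exists>f. f holomorphic_on (- {1}) \<and>
          (\<forall>z. Re z > 1 \<longrightarrow> (\<lambda>j::nat. (of_nat j + v) powr (- z)) sums f z)"
proof -
  define J where "J = nat \<lceil>1 - Re v\<rceil>"
  have J: "Re (of_nat J + v) \<ge> 1"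
    unfolding J_def by simp linarith
  obtain H where hol: "H holomorphic_on UNIV"
    and H: "\<And>s. Re s > 1 \<Longrightarrow> H s = (s - 1) * (\<Sum>j. (of_nat j + (of_nat J + v)) powr (- s))"
    using hurwitz_continuation_entire[OF J] by blast
  define f where "f s = H s / (s - 1) + (\<Sum>j<J. (of_nat j + v) powr (- s))" for s
  have "f holomorphic_on (- {1})"
    unfolding f_def by (intro holomorphic_intros holomorphic_on_subset[OF hol]) auto
  moreover have "(\<lambda>j. (of_nat j + v) powr (- z)) sums f z" if z: "Re z > 1" for z
  proof -
    have "z \<noteq> 1" using z by auto
    then have "H z / (z - 1) = (\<Sum>j. (of_nat j + (of_nat J + v)) powr (- z))"
      using H[OF z] by simp
    then have "(\<lambda>j. (of_nat (j + J) + v) powr (- z)) sums (H z / (z - 1))"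
      using summable_sums[OF holomorphic_hurwitz_series(2)[OF J z]] by (simp add: algebra_simps)
    then show ?thesis
      unfolding f_def by (rule sums_iff_shift[THEN iffD1])
  qed
  ultimately show ?thesis by blast
qed

section \<open>The duplication formula\<close>

lemma hurwitz_zeta_props:
  assumes "v \<notin> \<int>\<^sub>\<le>\<^sub>0"
  shows hurwitz_zeta_holomorphic: "(\<lambda>s. hurwitz_zeta s v) holomorphic_on (- {1})"
    and hurwitz_zeta_sums: "Re s > 1 \<Longrightarrow> (\<lambda>j::nat. (of_nat j + v) powr (- s)) sums hurwitz_zeta s v"
proof -
  have "(\<lambda>s. hurwitz_zeta s v) holomorphic_on (- {1}) \<and>
      (\<forall>z. Re z > 1 \<longrightarrow> (\<lambda>j::nat. (of_nat j + v) powr (- z)) sums hurwitz_zeta z v)"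
    unfolding hurwitz_zeta_def using someI_ex[OF hurwitz_continuation_exists[OF assms]] by blast
  then show "(\<lambda>s. hurwitz_zeta s v) holomorphic_on (- {1})"
    and "Re s > 1 \<Longrightarrow> (\<lambda>j::nat. (of_nat j + v) powr (- s)) sums hurwitz_zeta s v"
    by auto
qed

lemma two_times_powr: "(2 * w) powr z = 2 powr z * w powr z" for w z :: complex
  by (rule powr_times_real_left) auto

lemma half_notin_nonpos_Ints:
  fixes v :: complex
  assumes "v \<notin> \<int>\<^sub>\<le>\<^sub>0"
  shows "v / 2 \<notin> \<int>\<^sub>\<le>\<^sub>0" and "(v + 1) / 2 \<notin> \<int>\<^sub>\<le>\<^sub>0"
proof -
  show "v / 2 \<notin> \<int>\<^sub>\<le>\<^sub>0"
  proof
    assume "v / 2 \<in> \<int>\<^sub>\<le>\<^sub>0"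
    then obtain m where "v / 2 = - of_nat m" by (auto elim!: nonpos_Ints_cases')
    then have "v = - of_nat (2 * m)" by (simp add: field_simps)
    with assms show False by (simp only: minus_of_nat_in_nonpos_Ints not_True_eq_False)
  qed
  show "(v + 1) / 2 \<notin> \<int>\<^sub>\<le>\<^sub>0"
  proof
    assume "(v + 1) / 2 \<in> \<int>\<^sub>\<le>\<^sub>0"
    then obtain m where m: "(v + 1) / 2 = - of_nat m" by (auto elim!: nonpos_Ints_cases')
    have "v = 2 * ((v + 1) / 2) - 1" by (simp add: field_simps)
    also have "\<dots> = - of_nat (2 * m + 1)" unfolding m by simp
    finally have "v = - of_nat (2 * m + 1)" .
    with assms show False by (simp only: minus_of_nat_in_nonpos_Ints not_True_eq_False)
  qed
qed

text \<open>
  This is how regularity of the last arguments passes down to the earlier ones: a forbidden argument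
  would leave a forbidden one among its two halves.
\<close>

lemma nonpos_Ints_halving:
  fixes v :: complex
  assumes "v \<in> \<int>\<^sub>\<le>\<^sub>0"
  shows "v / 2 \<in> \<int>\<^sub>\<le>\<^sub>0 \<or> (v + 1) / 2 \<in> \<int>\<^sub>\<le>\<^sub>0"
proof -
  obtain m where m: "v = - of_nat m" using assms by (auto elim!: nonpos_Ints_cases')
  show ?thesis
  proof (cases "even m")
    case True
    then obtain i where "m = 2 * i" by blast
    then have "v / 2 = - of_nat i" using m by simp
    then show ?thesis by simp
  next
    case False
    then obtain i where "m = 2 * i + 1" by (blast elim: oddE)
    then have "(v + 1) / 2 = - of_nat i" using m by simp
    then show ?thesis by simp
  qed
qed

text \<open>
  For \<open>Re s > 1\<close>, the terms of the series for \<open>v\<close> with even index, multiplied by \<open>2 powr s\<close>, form the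
  series for \<open>v / 2\<close>, and those with odd index the series for \<open>(v + 1) / 2\<close>.
\<close>

lemma hurwitz_zeta_duplication:
  assumes v: "v \<notin> \<int>\<^sub>\<le>\<^sub>0" and "s \<noteq> 1"
  shows "hurwitz_zeta s (v / 2) + hurwitz_zeta s ((v + 1) / 2) = 2 powr s * hurwitz_zeta s v"
proof (rule analytic_continuation_open[where s = "{s. Re s > 1}" and s' = "- {1}"
      and f = "\<lambda>s. hurwitz_zeta s (v / 2) + hurwitz_zeta s ((v + 1) / 2)"
      and g = "\<lambda>s. 2 powr s * hurwitz_zeta s v"])
  note v' = half_notin_nonpos_Ints[OF v]
  show "(\<lambda>s. hurwitz_zeta s (v / 2) + hurwitz_zeta s ((v + 1) / 2)) holomorphic_on - {1}"
    by (intro holomorphic_on_add hurwitz_zeta_holomorphic v')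
  show "(\<lambda>s. 2 powr s * hurwitz_zeta s v) holomorphic_on - {1}"
    by (intro holomorphic_on_mult hurwitz_zeta_holomorphic v holomorphic_on_powr_right holomorphic_on_ident)
  show "open {s. Re s > 1}" by (rule open_halfspace_Re_gt)
  show "connected (- {1 :: complex})" by (rule connected_punctured_universe) simp
  show "{s. Re s > 1} \<noteq> {}" by (auto intro!: exI[of _ 2])
  show "hurwitz_zeta z (v / 2) + hurwitz_zeta z ((v + 1) / 2) = 2 powr z * hurwitz_zeta z v"
    if "z \<in> {s. Re s > 1}" for z
  proof -
    have z: "Re z > 1" using that by simp
    have pair: "(\<Sum>i\<in>{j * 2..<j * 2 + 2}. 2 powr z * (of_nat i + v) powr (- z)) =
        (of_nat j + v / 2) powr (- z) + (of_nat j + (v + 1) / 2) powr (- z)" for j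
    proof -
      have cancel: "2 powr z * (2 * w) powr (- z) = w powr (- z)" for w :: complex
        unfolding two_times_powr by (simp add: powr_minus)
      have "{j * 2..<j * 2 + 2} = {2 * j, 2 * j + 1}" by auto
      then have "(\<Sum>i\<in>{j * 2..<j * 2 + 2}. 2 powr z * (of_nat i + v) powr (- z)) =
          2 powr z * (of_nat (2 * j) + v) powr (- z) + 2 powr z * (of_nat (2 * j + 1) + v) powr (- z)"
        by simp
      moreover have "of_nat (2 * j) + v = 2 * (of_nat j + v / 2)"
        and "of_nat (2 * j + 1) + v = 2 * (of_nat j + (v + 1) / 2)" by (simp_all add: field_simps)
      ultimately show ?thesis by (simp only: cancel)
    qed
    have "(\<lambda>j. (of_nat j + v / 2) powr (- z) + (of_nat j + (v + 1) / 2) powr (- z)) sums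
            (2 powr z * hurwitz_zeta z v)"
      using sums_group[OF sums_mult[OF hurwitz_zeta_sums[OF v z], of "2 powr z"], of 2]
      unfolding pair by simp
    moreover have "(\<lambda>j. (of_nat j + v / 2) powr (- z) + (of_nat j + (v + 1) / 2) powr (- z)) sums
            (hurwitz_zeta z (v / 2) + hurwitz_zeta z ((v + 1) / 2))"
      by (intro sums_add hurwitz_zeta_sums v' z)
    ultimately show ?thesis by (rule sums_unique2[symmetric])
  qed
qed (use \<open>s \<noteq> 1\<close> in auto)

section \<open>The telescoping sum\<close>

text \<open>
  The telescoping step for index \<open>p\<close> needs \<open>1/3 - u p\<close> and \<open>2/3 - u p\<close> to be regular for every \<open>p < n\<close>, while
  regularity is assumed only for \<open>p = n\<close> and for the summands. It descends from \<open>p + 1\<close> to \<open>p\<close>: if one of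
  these numbers were a nonpositive integer, so would be one of its halves, and these occur either in
  the summand with index \<open>p + 1\<close> or in \<open>F (p + 1)\<close>.
\<close>

lemma hurwitz_zeta_telescoping_sum:
  fixes c k :: complex and n :: nat
  defines "u \<equiv> \<lambda>p. c / 2 ^ p"
  defines "F \<equiv> \<lambda>p. hurwitz_zeta (- k) (1/3 - u p) + hurwitz_zeta (- k) (2/3 - u p)"
  assumes k: "k \<noteq> -1"
    and inner: "\<And>p. p \<in> {1..n} \<Longrightarrow> 1/6 - u p \<notin> \<int>\<^sub>\<le>\<^sub>0 \<and> 5/6 - u p \<notin> \<int>\<^sub>\<le>\<^sub>0"
    and last: "1/3 - u n \<notin> \<int>\<^sub>\<le>\<^sub>0" "2/3 - u n \<notin> \<int>\<^sub>\<le>\<^sub>0"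
  shows "(\<Sum>p=1..n. (- (2 ^ (1 + p))) powr k *
            (hurwitz_zeta (- k) (1/6 - u p) + hurwitz_zeta (- k) (5/6 - u p))) =
         (- 2) powr k * F 0 - (- (2 ^ (1 + n))) powr k * F n"
proof -
  have u_Suc: "2 * u (Suc p) = u p" for p by (simp add: u_def)
  have halves: "(1/3 - u p) / 2 = 1/6 - u (Suc p)" "((1/3 - u p) + 1) / 2 = 2/3 - u (Suc p)"
      "(2/3 - u p) / 2 = 1/3 - u (Suc p)" "((2/3 - u p) + 1) / 2 = 5/6 - u (Suc p)" for p
    unfolding u_Suc[of p, symmetric] by (simp_all add: field_simps)
  have regular: "1/3 - u p \<notin> \<int>\<^sub>\<le>\<^sub>0 \<and> 2/3 - u p \<notin> \<int>\<^sub>\<le>\<^sub>0" if "p \<le> n" for p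
    using that
  proof (induction rule: inc_induct)
    case base
    show ?case using last by simp
  next
    case (step p)
    then have "1/6 - u (Suc p) \<notin> \<int>\<^sub>\<le>\<^sub>0 \<and> 5/6 - u (Suc p) \<notin> \<int>\<^sub>\<le>\<^sub>0" by (intro inner) auto
    with step.IH show ?case
      using nonpos_Ints_halving[of "1/3 - u p"] nonpos_Ints_halving[of "2/3 - u p"]
      unfolding halves by blast
  qed
  define T where "T p = (- (2 ^ (1 + p))) powr k * F p" for p
  have term_eq: "(- (2 ^ (1 + Suc p))) powr k *
            (hurwitz_zeta (- k) (1/6 - u (Suc p)) + hurwitz_zeta (- k) (5/6 - u (Suc p))) =
        T p - T (Suc p)" if "p < n" for p
  proof -
    have "- k \<noteq> 1" using k by (metis minus_minus)
    note dup = hurwitz_zeta_duplication[OF _ this]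
    have "hurwitz_zeta (- k) (1/6 - u (Suc p)) + hurwitz_zeta (- k) (2/3 - u (Suc p)) =
          2 powr (- k) * hurwitz_zeta (- k) (1/3 - u p)"
      and "hurwitz_zeta (- k) (1/3 - u (Suc p)) + hurwitz_zeta (- k) (5/6 - u (Suc p)) =
          2 powr (- k) * hurwitz_zeta (- k) (2/3 - u p)"
      using dup[of "1/3 - u p"] dup[of "2/3 - u p"] regular[of p] that unfolding halves by auto
    then have G: "hurwitz_zeta (- k) (1/6 - u (Suc p)) + hurwitz_zeta (- k) (5/6 - u (Suc p)) =
        2 powr (- k) * F p - F (Suc p)"
      unfolding F_def by algebra
    have "(- (2 ^ (1 + Suc p))) powr k = 2 powr k * (- (2 ^ (1 + p))) powr k"
      using two_times_powr[of "- (2 ^ (1 + p))" k] by simp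
    then have "(- (2 ^ (1 + Suc p))) powr k * 2 powr (- k) = (- (2 ^ (1 + p))) powr k"
      by (simp add: powr_minus)
    then show ?thesis unfolding G T_def right_diff_distrib by (simp only: flip: mult.assoc)
  qed
  have "(\<Sum>p=1..n. (- (2 ^ (1 + p))) powr k *
            (hurwitz_zeta (- k) (1/6 - u p) + hurwitz_zeta (- k) (5/6 - u p))) =
        (\<Sum>p<n. (- (2 ^ (1 + Suc p))) powr k *
            (hurwitz_zeta (- k) (1/6 - u (Suc p)) + hurwitz_zeta (- k) (5/6 - u (Suc p))))"
    unfolding One_nat_def by (rule sum.atLeast1_atMost_eq)
  also have "\<dots> = (\<Sum>p<n. T p - T (Suc p))"
    by (intro sum.cong refl term_eq) simp
  also have "\<dots> = T 0 - T n"
    by (rule sum_lessThan_telescope')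
  finally show ?thesis by (simp add: T_def)
qed

theorem theorem4p115:
  fixes n :: nat and k a :: complex
  assumes "n \<ge> 1" and "a \<noteq> 0" and "k \<noteq> -1"
    and "\<And>p. p \<in> {1..n} \<Longrightarrow> 1/6 * (1 - 3 * 2 powi (- int p) * Ln a / of_real pi) \<notin> \<int>\<^sub>\<le>\<^sub>0"
    and "\<And>p. p \<in> {1..n} \<Longrightarrow> 1/6 * (5 - 3 * 2 powi (- int p) * Ln a / of_real pi) \<notin> \<int>\<^sub>\<le>\<^sub>0"
    and "1/3 - Ln a / (2 * of_real pi) \<notin> \<int>\<^sub>\<le>\<^sub>0"
    and "2/3 - Ln a / (2 * of_real pi) \<notin> \<int>\<^sub>\<le>\<^sub>0"
    and "1/6 * (2 - 3 * 2 powi (- int n) * Ln a / of_real pi) \<notin> \<int>\<^sub>\<le>\<^sub>0"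
    and "1/6 * (4 - 3 * 2 powi (- int n) * Ln a / of_real pi) \<notin> \<int>\<^sub>\<le>\<^sub>0"
  shows "(\<Sum>p=1..n. (- (2 ^ (1 + p))) powr k *
            (hurwitz_zeta (- k) (1/6 * (1 - 3 * 2 powi (- int p) * Ln a / of_real pi)) +
             hurwitz_zeta (- k) (1/6 * (5 - 3 * 2 powi (- int p) * Ln a / of_real pi)))) =
         (- 2) powr k *
            (hurwitz_zeta (- k) (1/3 - Ln a / (2 * of_real pi)) +
             hurwitz_zeta (- k) (2/3 - Ln a / (2 * of_real pi))) -
         (- (2 ^ (1 + n))) powr k *
            (hurwitz_zeta (- k) (1/6 * (2 - 3 * 2 powi (- int n) * Ln a / of_real pi)) +
             hurwitz_zeta (- k) (1/6 * (4 - 3 * 2 powi (- int n) * Ln a / of_real pi)))"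
proof -
  define c where "c = Ln a / (2 * of_real pi)"
  have arg: "1/6 * (r - 3 * 2 powi (- int p) * Ln a / of_real pi) = r / 6 - c / 2 ^ p" for r p
  proof -
    have "2 powi (- int p) = inverse (2 ^ p :: complex)"
      by (simp only: power_int_minus power_int_of_nat)
    moreover have "1/6 * (r - 3 * inverse t * L / q) = r / 6 - L / (2 * q) / t"
      if "t \<noteq> 0" "q \<noteq> 0" for t L q :: complex
      using that by (simp add: field_simps)
    from this[of "2 ^ p" "of_real pi"]
    have "1/6 * (r - 3 * inverse (2 ^ p) * Ln a / of_real pi) = r / 6 - Ln a / (2 * of_real pi) / 2 ^ p"
      by simp
    ultimately show ?thesis unfolding c_def by (simp only:)
  qed
  have frac: "(2::complex) / 6 = 1/3" "(4::complex) / 6 = 2/3" by simp_all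
  have inner: "1/6 - c / 2 ^ p \<notin> \<int>\<^sub>\<le>\<^sub>0 \<and> 5/6 - c / 2 ^ p \<notin> \<int>\<^sub>\<le>\<^sub>0" if "p \<in> {1..n}" for p
    using assms(4,5)[OF that] unfolding arg by blast
  have last: "1/3 - c / 2 ^ n \<notin> \<int>\<^sub>\<le>\<^sub>0" "2/3 - c / 2 ^ n \<notin> \<int>\<^sub>\<le>\<^sub>0"
    using assms(8,9) unfolding arg frac by blast+
  show ?thesis
    unfolding arg frac unfolding c_def[symmetric]
    by (rule hurwitz_zeta_telescoping_sum[of k n c, OF \<open>k \<noteq> -1\<close> inner last, unfolded power_0 div_by_1])
qed

end
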